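(* Let $V$ and $W$ be finite-dimensional normed vector spaces over $\mathbb{R}$, let $x_0\in V$ and $\varepsilon>0$, and let $f\colon B(x_0,\varepsilon)\to W$ be a $C^1$ function. Suppose $T\colon W\to V$ is a linear operator such that \[\|Df(x)\circ T-\mathrm{id}_W\| < 1-\frac{\|T\|\cdot|f(x_0)|}{\varepsilon}\] for all $x\in B(x_0,\varepsilon)$. Then there exists $x_*\in B(x_0,\varepsilon)$ with $f(x_* )=0$. Moreover, within $B(x_0,\varepsilon)$ the zero locus $f^{-1}(0)$ is a $C^1$ submanifold of dimension $\dim V-\dim W$.
   Context: $B(x_0,\varepsilon)$ denotes the open ball of radius $\varepsilon$ about $x_0$ in $V$, $|\cdot|$ denotes the norms on $V$ and $W$, $\|\cdot\|$ denotes the induced operator norm, $Df(x)$ is the derivative (Jacobian) of $f$ at $x$, and $\mathrm{id}_W$ is the identity on $W$. *)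

theory Defs
  imports "HOL-Analysis.Analysis"
begin

definition C1_on :: "'a::real_normed_vector set \<Rightarrow> ('a \<Rightarrow> 'b::real_normed_vector) \<Rightarrow> bool" where
  "C1_on S f \<longleftrightarrow> (\<exists>f'. (\<forall>x\<in>S. (f has_derivative blinfun_apply (f' x)) (at x)) \<and> continuous_on S f')"

definition C1_diffeo :: "'a::real_normed_vector set \<Rightarrow> 'a set \<Rightarrow> ('a \<Rightarrow> 'a) \<Rightarrow> bool" where
  "C1_diffeo U U' \<phi> \<longleftrightarrow> open U \<and> open U' \<and> bij_betw \<phi> U U' \<and> C1_on U \<phi> \<and> C1_on U' (inv_into U \<phi>)"

definition C1_submanifold :: "'a::real_normed_vector set \<Rightarrow> nat \<Rightarrow> bool" where
  "C1_submanifold M k \<longleftrightarrow>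
     (\<forall>p\<in>M. \<exists>U U' \<phi> L. p \<in> U \<and> C1_diffeo U U' \<phi> \<and> subspace L \<and> dim L = k
                        \<and> \<phi> ` (M \<inter> U) = U' \<inter> L)"

end

theory Submission
  imports Defs
begin

text \<open>
  Pulled back along \<open>w \<mapsto> x0 + T w\<close>, the map \<open>f\<close> becomes a map \<open>h\<close> on a ball of \<open>W\<close> whose
  derivative is close to the identity, so \<open>w \<mapsto> w - h w\<close> is a contraction and its fixed
  point is a zero. At a zero \<open>p\<close> the operator \<open>D = Df(p)\<close> has the right inverse
  \<open>S = T (D T)\<^sup>-\<^sup>1\<close>, and \<open>\<phi> x = (x - p) - S D (x - p) + S (f x)\<close> is a local
  \<open>C\<^sup>1\<close> diffeomorphism carrying the zero set of \<open>f\<close> to \<open>ker D\<close>.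
\<close>

section \<open>Compactness, completeness and dimension in finite-dimensional normed spaces\<close>

text \<open>The norm is arbitrary and finite dimension means a finite spanning set, so Heine-Borel
  goes by induction on that set. A new vector \<open>b\<close> outside \<open>span B\<close> has a
  positive distance \<open>d\<close> from it, which bounds the coefficient of \<open>b\<close> in a
  vector of norm at most \<open>r\<close> by \<open>r/d\<close>. The slice is then the part in a
  closed ball of a sum of two compact sets.\<close>

lemma compact_span_Int_cball:
  fixes B :: "'a::real_normed_vector set"
  assumes "finite B"
  shows "compact (span B \<inter> cball 0 r)"
  using assms
proof (induction B arbitrary: r rule: finite_induct)
  case empty
  show ?case by (simp add: compact_Int_closed)
next
  case (insert b B)
  show ?case
  proof (cases "b \<in> span B")
    case True
    then show ?thesis using insert.IH by (simp add: span_redundant)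
  next
    case False
    \<comment> \<open>Closedness of this bounded part suffices: points of \<open>span B\<close> of
      norm above \<open>norm b + 1\<close> are at distance at least 1 from \<open>b\<close> anyway,
      whence the minimum with 1 in \<open>d\<close>.\<close>
    have "closed (span B \<inter> cball 0 (norm b + 1))"
      using insert.IH compact_imp_closed by blast
    then have "open (- (span B \<inter> cball 0 (norm b + 1)))" by (rule open_Compl)
    then obtain d0 where "d0 > 0" "ball b d0 \<subseteq> - (span B \<inter> cball 0 (norm b + 1))"
      using False by (auto elim: openE)
    then have d0: "d0 > 0" "\<And>s. s \<in> span B \<inter> cball 0 (norm b + 1) \<Longrightarrow> d0 \<le> dist b s"
      by (simp, meson ComplD linorder_not_le mem_ball subsetD)
    define d where "d = min d0 1"
    have d: "d > 0" using d0 by (simp add: d_def)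
    have dle: "d \<le> norm (b - s)" if s: "s \<in> span B" for s
    proof (cases "norm s \<le> norm b + 1")
      case True
      then show ?thesis using d0(2)[of s] s by (simp add: d_def dist_norm)
    next
      case False
      then show ?thesis using norm_triangle_ineq2[of s b] by (simp add: d_def norm_minus_commute)
    qed
    \<comment> \<open>Dividing by \<open>k\<close> turns \<open>x\<close> into a difference of
      \<open>b\<close> and an element of \<open>span B\<close>, which has norm at least
      \<open>d\<close>.\<close>
    have kle: "\<bar>k\<bar> * d \<le> norm x" if "x - k *\<^sub>R b \<in> span B" for x k
    proof (cases "k = 0")
      case False
      have "(-1/k) *\<^sub>R (x - k *\<^sub>R b) \<in> span B" using that by (rule span_scale)
      then have "d \<le> norm (b - (-1/k) *\<^sub>R (x - k *\<^sub>R b))" by (rule dle)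
      also have "b - (-1/k) *\<^sub>R (x - k *\<^sub>R b) = (1/k) *\<^sub>R x"
        using False by (simp add: algebra_simps)
      finally show ?thesis using False by (simp add: field_simps)
    qed simp
    \<comment> \<open>A segment of multiples of \<open>b\<close> plus a slice of
      \<open>span B\<close>; the radius of the slice is the triangle-inequality bound on
      \<open>x - k *\<^sub>R b\<close> for coefficients of size at most \<open>r/d\<close>.\<close>
    define K where "K = {x + y |x y. x \<in> (\<lambda>k. k *\<^sub>R b) ` {-(r/d)..r/d} \<and>
        y \<in> span B \<inter> cball 0 (r + r/d * norm b)}"
    have "compact K" unfolding K_def
      by (intro compact_sums compact_continuous_image insert.IH continuous_intros) auto
    moreover have "span (insert b B) \<inter> cball 0 r = K \<inter> cball 0 r"
    proof (intro equalityI subsetI)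
      fix x assume x: "x \<in> span (insert b B) \<inter> cball 0 r"
      then obtain k where k: "x - k *\<^sub>R b \<in> span B" by (auto simp: span_breakdown_eq)
      have "\<bar>k\<bar> * d \<le> r" using kle[OF k] x by simp
      then have kr: "\<bar>k\<bar> \<le> r/d" using d by (simp add: field_simps)
      have "norm (x - k *\<^sub>R b) \<le> norm x + \<bar>k\<bar> * norm b"
        using norm_triangle_ineq4[of x "k *\<^sub>R b"] by simp
      also have "\<dots> \<le> r + r/d * norm b"
        using x kr by (intro add_mono mult_right_mono) auto
      finally have "x - k *\<^sub>R b \<in> span B \<inter> cball 0 (r + r/d * norm b)" using k by simp
      moreover have "k *\<^sub>R b \<in> (\<lambda>k. k *\<^sub>R b) ` {-(r/d)..r/d}"
        using kr by (intro imageI) (auto simp: abs_le_iff)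
      moreover have "x = k *\<^sub>R b + (x - k *\<^sub>R b)" by simp
      ultimately show "x \<in> K \<inter> cball 0 r" using x unfolding K_def by blast
    next
      fix x assume x: "x \<in> K \<inter> cball 0 r"
      then obtain k y where "x = k *\<^sub>R b + y" "y \<in> span B" unfolding K_def by blast
      then have "x \<in> span (insert b B)" by (metis add_diff_cancel_left' span_breakdown_eq)
      then show "x \<in> span (insert b B) \<inter> cball 0 r" using x by simp
    qed
    ultimately show ?thesis by (simp add: compact_Int_closed)
  qed
qed

lemma compact_cball_finite_dim:
  fixes a :: "'a::real_normed_vector"
  assumes "\<exists>B::'a set. finite B \<and> span B = UNIV"
  shows "compact (cball a r)"
proof -
  obtain B :: "'a set" where "finite B" "span B = UNIV" using assms by blast
  then have "compact (cball (0::'a) r)" using compact_span_Int_cball[of B r] by simp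
  then show ?thesis using compact_translation[of "cball 0 r" a] by (simp add: cball_translation)
qed

text \<open>Cauchy sequences are bounded and so stay in a compact ball. This supplies the
  completeness that the fixed-point arguments require.\<close>

lemma complete_UNIV_finite_dim:
  assumes "\<exists>B::'a::real_normed_vector set. finite B \<and> span B = UNIV"
  shows "complete (UNIV::'a set)"
  unfolding complete_def
proof (intro allI impI)
  fix X :: "nat \<Rightarrow> 'a" assume X: "(\<forall>n. X n \<in> UNIV) \<and> Cauchy X"
  then have "bounded (range X)" by (intro cauchy_imp_bounded) simp
  then obtain a r where r: "range X \<subseteq> cball a r"
    unfolding bounded_subset_cball by blast
  have "complete (cball a r)"
    by (intro compact_imp_complete compact_cball_finite_dim assms)
  then show "\<exists>l\<in>UNIV. X \<longlonglongrightarrow> l" using X r unfolding complete_def by blast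
qed

text \<open>\<open>S\<close> is injective, and the domain of \<open>D\<close> is the direct sum of
  the kernel and \<open>range S\<close> through \<open>v = (v - S (D v)) + S (D v)\<close>. In
  particular the subtraction of natural numbers does not truncate.\<close>

lemma dim_kernel_of_right_inverse:
  fixes D :: "'v::real_normed_vector \<Rightarrow> 'w::real_normed_vector" and S :: "'w \<Rightarrow> 'v"
  assumes finV: "\<exists>B::'v set. finite B \<and> span B = UNIV"
    and finW: "\<exists>B::'w set. finite B \<and> span B = UNIV"
    and D: "linear D" and S: "linear S" and DS: "\<And>w. D (S w) = w"
  shows "dim {v. D v = 0} = dim (UNIV::'v set) - dim (UNIV::'w set)"
proof -
  have fin_basis: "\<exists>B::'b set. finite B \<and> independent B \<and> span B = UNIV"
    if "\<exists>B::'b::real_vector set. finite B \<and> span B = UNIV"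
    using that by (metis maximal_independent_subset finite_subset span_eq subset_UNIV)
  obtain BV :: "'v set" where BV: "finite BV" "independent BV" "span BV = UNIV"
    using fin_basis[OF finV] by blast
  obtain BW :: "'w set" where BW: "finite BW" "independent BW" "span BW = UNIV"
    using fin_basis[OF finW] by blast
  interpret V: finite_dimensional_vector_space "scaleR :: real \<Rightarrow> 'v \<Rightarrow> 'v" BV
    by unfold_locales (use BV in \<open>auto simp: dependent_raw_def span_raw_def\<close>)
  interpret WV: finite_dimensional_vector_space_pair_1 "scaleR :: real \<Rightarrow> 'w \<Rightarrow> 'w" BW "scaleR :: real \<Rightarrow> 'v \<Rightarrow> 'v"
    by unfold_locales (use BW in \<open>auto simp: dependent_raw_def span_raw_def\<close>)
  have "inj S" using DS by (metis injI)
  then have "dim (range S) = dim (UNIV::'w set)"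
    using WV.dim_image_eq[of S UNIV] S by (auto simp: dim_raw_def linear_def intro: inj_on_subset)
  moreover have "dim {x + y |x y. x \<in> {v. D v = 0} \<and> y \<in> range S} + dim ({v. D v = 0} \<inter> range S)
      = dim {v. D v = 0} + dim (range S)"
    using V.dim_sums_Int[of "{v. D v = 0}" "range S"] linear_subspace_kernel[OF D]
       linear_subspace_image[OF S subspace_UNIV]
    by (auto simp: dim_raw_def subspace_raw_def)
  moreover have "{x + y |x y. x \<in> {v. D v = 0} \<and> y \<in> range S} = UNIV"
  proof -
    have "D (v - S (D v)) = 0" "v = (v - S (D v)) + S (D v)" for v
      using D DS by (simp_all add: linear_diff)
    then show ?thesis by blast
  qed
  moreover have "{v. D v = 0} \<inter> range S = {0}"
    using DS linear_0[OF S] linear_0[OF D] by auto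
  ultimately show ?thesis by (simp add: dim_raw_def)
qed

section \<open>Maps and operators close to the identity\<close>

text \<open>Mean value inequality for \<open>g\<close> minus the identity, whose derivative is
  \<open>g' x - id_blinfun\<close>. The contraction estimates for nonlinear maps come from
  here.\<close>

lemma near_id_lipschitz:
  fixes g :: "'a::real_normed_vector \<Rightarrow> 'a"
  assumes "convex S"
    and deriv: "\<And>x. x \<in> S \<Longrightarrow> (g has_derivative blinfun_apply (g' x)) (at x)"
    and bound: "\<And>x. x \<in> S \<Longrightarrow> norm (g' x - id_blinfun) \<le> q"
    and "x \<in> S" "y \<in> S"
  shows "norm ((g x - x) - (g y - y)) \<le> q * norm (x - y)"
proof (rule differentiable_bound[OF \<open>convex S\<close> _ _ \<open>x \<in> S\<close> \<open>y \<in> S\<close>])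
  fix z assume z: "z \<in> S"
  have "((\<lambda>x. g x - x) has_derivative (\<lambda>h. g' z h - h)) (at z within S)"
    by (intro has_derivative_diff has_derivative_at_withinI[OF deriv[OF z]] has_derivative_ident)
  then show "((\<lambda>x. g x - x) has_derivative blinfun_apply (g' z - id_blinfun)) (at z within S)"
    by (simp add: minus_blinfun.rep_eq)
  show "onorm (blinfun_apply (g' z - id_blinfun)) \<le> q"
    using bound[OF z] by (simp add: norm_blinfun.rep_eq)
qed

text \<open>Solutions of \<open>g x = y\<close> are the fixed points of \<open>x - g x + y\<close>.
  By \<open>lip\<close> this map is a contraction and by \<open>self\<close> it preserves the ball,
  so Banach's theorem applies.\<close>

lemma near_id_solve:
  fixes g :: "'a::real_normed_vector \<Rightarrow> 'a"
  assumes "complete (UNIV::'a set)" "0 \<le> q" "q < 1" "0 \<le> s"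
    and lip: "\<And>x z. x \<in> cball a s \<Longrightarrow> z \<in> cball a s \<Longrightarrow>
                norm ((g x - x) - (g z - z)) \<le> q * norm (x - z)"
    and self: "\<And>x. x \<in> cball a s \<Longrightarrow> norm (x - g x + y - a) \<le> s"
  shows "\<exists>x\<in>cball a s. g x = y"
proof -
  have "complete (UNIV \<inter> cball a s)"
    using assms(1) closed_cball by (rule complete_Int_closed)
  then have "complete (cball a s)" by simp
  then have "\<exists>!x\<in>cball a s. x - g x + y = x"
  proof (rule Banach_fix[OF _ _ \<open>0 \<le> q\<close> \<open>q < 1\<close>])
    show "cball a s \<noteq> {}" using \<open>0 \<le> s\<close> by simp
    show "(\<lambda>x. x - g x + y) ` cball a s \<subseteq> cball a s"
      using self by (auto simp: dist_norm norm_minus_commute)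
    show "dist (x - g x + y) (z - g z + y) \<le> q * dist x z"
      if "x \<in> cball a s" "z \<in> cball a s" for x z
      using lip[OF that] by (simp add: dist_norm norm_minus_commute algebra_simps)
  qed
  then obtain x where "x \<in> cball a s" "x - g x + y = x" by blast
  then show ?thesis by (intro bexI[of _ x]) (auto simp: algebra_simps)
qed

text \<open>The Neumann series statement, proved by solving \<open>A x = y\<close> as a fixed-point
  problem. The lower estimate on \<open>norm (A x)\<close> gives both injectivity and the norm of
  the inverse.\<close>

lemma blinfun_near_id_invertible:
  fixes A :: "'a::real_normed_vector \<Rightarrow>\<^sub>L 'a"
  assumes compl: "complete (UNIV::'a set)" and A: "norm (A - id_blinfun) \<le> q" and "q < 1"
  obtains A' where "A o\<^sub>L A' = id_blinfun" "A' o\<^sub>L A = id_blinfun" "norm A' \<le> 1 / (1 - q)"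
proof -
  have q: "0 \<le> q" using A norm_ge_zero order_trans by blast
  have lip: "norm (A x - x) \<le> q * norm x" for x
  proof -
    have "norm (A x - x) = norm ((A - id_blinfun) x)" by (simp add: blinfun.diff_left)
    also have "\<dots> \<le> norm (A - id_blinfun) * norm x" by (rule norm_blinfun)
    also have "\<dots> \<le> q * norm x" using A by (intro mult_right_mono) auto
    finally show ?thesis .
  qed
  have lower: "norm x \<le> 1 / (1 - q) * norm (A x)" for x
  proof -
    have "norm x - norm (A x) \<le> q * norm x"
      using lip[of x] norm_triangle_ineq2[of x "A x"] by (simp add: norm_minus_commute)
    then show ?thesis using \<open>q < 1\<close> by (simp add: field_simps)
  qed
  have inj: "x = y" if "A x = A y" for x y
    using lower[of "x - y"] that by (simp add: blinfun.diff_right)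
  have surj: "\<exists>x. A x = y" for y
  proof -
    \<comment> \<open>The smallest radius with \<open>q * s + norm y \<le> s\<close>, which is the
      self-map condition.\<close>
    let ?s = "norm y / (1 - q)"
    have "\<exists>x\<in>cball 0 ?s. A x = y"
    proof (rule near_id_solve[OF compl q \<open>q < 1\<close>])
      show "0 \<le> ?s" using \<open>q < 1\<close> by simp
      show "norm ((A x - x) - (A z - z)) \<le> q * norm (x - z)" for x z
        using lip[of "x - z"] by (simp add: blinfun.diff_right algebra_simps)
      show "norm (x - A x + y - 0) \<le> ?s" if "x \<in> cball 0 ?s" for x
      proof -
        have "norm (x - A x + y - 0) \<le> norm (A x - x) + norm y"
          using norm_triangle_ineq[of "x - A x" y] by (simp add: norm_minus_commute)
        also have "\<dots> \<le> q * ?s + norm y"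
          using lip[of x] that q by (smt (verit) mem_cball_0 mult_left_mono)
        also have "\<dots> = ?s" using \<open>q < 1\<close> by (simp add: field_simps)
        finally show ?thesis .
      qed
    qed
    then show ?thesis by blast
  qed
  define B where "B y = (SOME x. A x = y)" for y
  have AB: "A (B y) = y" for y unfolding B_def by (rule someI_ex) (rule surj)
  have BA: "B (A x) = x" for x by (rule inj) (rule AB)
  \<comment> \<open>Preimages under \<open>A\<close> are unique, so linearity of the chosen inverse
    is checked after applying \<open>A\<close>.\<close>
  have "bounded_linear B"
  proof (rule bounded_linear_intro)
    show "B (x + y) = B x + B y" for x y by (rule inj) (simp add: AB blinfun.add_right)
    show "B (r *\<^sub>R x) = r *\<^sub>R B x" for r x by (rule inj) (simp add: AB blinfun.scaleR_right)
    show "norm (B x) \<le> norm x * (1 / (1 - q))" for x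
      using lower[of "B x"] by (simp add: AB mult.commute)
  qed
  then have B: "blinfun_apply (Blinfun B) = B" by (rule bounded_linear_Blinfun_apply)
  show thesis
  proof
    show "A o\<^sub>L Blinfun B = id_blinfun" "Blinfun B o\<^sub>L A = id_blinfun"
      by (auto intro!: blinfun_eqI simp: B AB BA)
    show "norm (Blinfun B) \<le> 1 / (1 - q)"
      using \<open>q < 1\<close> lower[of "B x" for x] by (intro norm_blinfun_bound) (auto simp: B AB)
  qed
qed

section \<open>The inverse function theorem\<close>

text \<open>Normalized to derivative the identity at \<open>p\<close>. Near \<open>p\<close> the map
  is the identity plus a 1/2-Lipschitz map, so it shrinks distances by at most a factor 2 and covers
  a ball about \<open>g p\<close>. The derivative of the inverse is the inverted derivative of
  \<open>g\<close>, and inversion is continuous where the inverses are bounded.\<close>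

lemma local_C1_diffeo:
  fixes g :: "'a::real_normed_vector \<Rightarrow> 'a"
  assumes compl: "complete (UNIV::'a set)" and N: "open N" "p \<in> N"
    and deriv: "\<And>x. x \<in> N \<Longrightarrow> (g has_derivative blinfun_apply (g' x)) (at x)"
    and cont: "continuous_on N g'" and "g' p = id_blinfun"
  obtains U U' where "p \<in> U" "U \<subseteq> N" "C1_diffeo U U' g"
proof -
  have "continuous (at p) g'" using cont N continuous_on_eq_continuous_at by blast
  then obtain d1 where d1: "d1 > 0" "\<And>x. dist x p < d1 \<Longrightarrow> dist (g' x) (g' p) < 1/2"
    unfolding continuous_at_eps_delta by (metis half_gt_zero zero_less_one)
  obtain d2 where d2: "d2 > 0" "ball p d2 \<subseteq> N" using N by (auto elim: openE)
  define d where "d = min d1 d2"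
  have d: "d > 0" "ball p d \<subseteq> N" using d1 d2 by (auto simp: d_def)
  have near: "norm (g' x - id_blinfun) \<le> 1/2" if "x \<in> ball p d" for x
    using d1(2)[of x] that \<open>g' p = id_blinfun\<close> by (simp add: d_def dist_norm norm_minus_commute)
  have lip: "norm ((g x - x) - (g y - y)) \<le> 1/2 * norm (x - y)" if "x \<in> ball p d" "y \<in> ball p d" for x y
    by (rule near_id_lipschitz[OF convex_ball _ near that]) (use deriv d in auto)
  have lower: "norm (x - y) \<le> 2 * norm (g x - g y)" if "x \<in> ball p d" "y \<in> ball p d" for x y
  proof -
    have "norm (x - y) - norm (g x - g y) \<le> norm ((x - y) - (g x - g y))"
      by (rule norm_triangle_ineq2)
    also have "\<dots> = norm ((g x - x) - (g y - y))"
      by (simp add: norm_minus_commute algebra_simps)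
    finally show ?thesis using lip[OF that] by simp
  qed
  have contg: "continuous_on N g"
    using deriv has_derivative_continuous continuous_at_imp_continuous_on by blast
  \<comment> \<open>The radius is \<open>d/2\<close> because solving \<open>g x = y\<close> takes a
    ball about \<open>p\<close> of radius twice the distance from \<open>y\<close> to
    \<open>g p\<close>, and this must stay inside \<open>ball p d\<close>.\<close>
  define U' where "U' = ball (g p) (d/2)"
  define U where "U = ball p d \<inter> g -` U'"
  have "open U'" by (simp add: U'_def)
  have "open U" unfolding U_def U'_def
    by (intro continuous_open_preimage continuous_on_subset[OF contg] d) auto
  have UN: "U \<subseteq> N" using d by (auto simp: U_def)
  have pU: "p \<in> U" using d by (auto simp: U_def U'_def)
  have inj: "inj_on g U"
  proof (rule inj_onI)
    fix x y assume "x \<in> U" "y \<in> U" "g x = g y"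
    then show "x = y" using lower[of x y] by (simp add: U_def)
  qed
  have "U' \<subseteq> g ` U"
  proof
    fix y assume y: "y \<in> U'"
    define s where "s = 2 * norm (y - g p)"
    have s: "0 \<le> s" "s < d" using y by (auto simp: s_def U'_def dist_norm norm_minus_commute)
    then have sub: "cball p s \<subseteq> ball p d" by auto
    have "\<exists>x\<in>cball p s. g x = y"
    proof (rule near_id_solve[OF compl, where q = "1/2"])
      show "norm ((g x - x) - (g z - z)) \<le> 1/2 * norm (x - z)"
        if "x \<in> cball p s" "z \<in> cball p s" for x z
        using lip that sub by blast
      show "norm (x - g x + y - p) \<le> s" if x: "x \<in> cball p s" for x
      proof -
        have "x - g x + y - p = (y - g p) - ((g x - x) - (g p - p))" by simp
        then have "norm (x - g x + y - p) \<le> norm (y - g p) + norm ((g x - x) - (g p - p))"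
          by (metis norm_triangle_ineq4)
        also have "\<dots> \<le> s/2 + 1/2 * norm (x - p)"
          using lip[of x p] x sub d by (intro add_mono) (auto simp: s_def)
        also have "\<dots> \<le> s" using x by (simp add: dist_norm norm_minus_commute)
        finally show ?thesis .
      qed
    qed (use s in auto)
    then show "y \<in> g ` U" using sub y by (auto simp: U_def)
  qed
  then have img: "g ` U = U'" by (auto simp: U_def)
  then have bij: "bij_betw g U U'" using inj by (simp add: bij_betw_def)
  define \<psi> where "\<psi> = inv_into U g"
  have \<psi>U: "\<psi> y \<in> U" and g\<psi>: "g (\<psi> y) = y" if "y \<in> U'" for y
    using that img by (auto simp: \<psi>_def inv_into_into f_inv_into_f)
  \<comment> \<open>The lower estimate read for preimages; it gives the continuity of \<psi> that
    its differentiability relies on.\<close>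
  have "2-lipschitz_on U' \<psi>"
  proof (rule lipschitz_onI)
    show "dist (\<psi> x) (\<psi> y) \<le> 2 * dist x y" if "x \<in> U'" "y \<in> U'" for x y
      using lower[of "\<psi> x" "\<psi> y"] \<psi>U[OF that(1)] \<psi>U[OF that(2)] g\<psi> that
      by (simp add: dist_norm U_def)
  qed simp
  then have cont\<psi>: "continuous_on U' \<psi>" by (rule lipschitz_on_continuous_on)
  have "\<exists>A'. g' x o\<^sub>L A' = id_blinfun \<and> A' o\<^sub>L g' x = id_blinfun \<and> norm A' \<le> 2" if "x \<in> U" for x
    using blinfun_near_id_invertible[OF compl near[of x]] that by (auto simp: U_def)
  then obtain I where I: "\<And>x. x \<in> U \<Longrightarrow> g' x o\<^sub>L I x = id_blinfun"
      "\<And>x. x \<in> U \<Longrightarrow> I x o\<^sub>L g' x = id_blinfun" "\<And>x. x \<in> U \<Longrightarrow> norm (I x) \<le> 2"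
    by metis
  have Ilip: "norm (I x - I y) \<le> 4 * norm (g' x - g' y)" if "x \<in> U" "y \<in> U" for x y
  proof -
    \<comment> \<open>Resolvent identity; with both inverses of norm at most 2 it yields the
      constant 4.\<close>
    have "I x - I y = I x o\<^sub>L (g' y - g' x) o\<^sub>L I y"
    proof (rule blinfun_eqI)
      fix v
      have "I x (g' x (I y v)) = I y v" "g' y (I y v) = v"
        using I(2)[OF that(1)] I(1)[OF that(2)]
        by (metis blinfun_apply_blinfun_compose id_blinfun.rep_eq)+
      then show "(I x - I y) v = (I x o\<^sub>L (g' y - g' x) o\<^sub>L I y) v"
        by (simp add: blinfun.diff_left blinfun.diff_right)
    qed
    then have "norm (I x - I y) \<le> norm (I x o\<^sub>L (g' y - g' x)) * norm (I y)"
      using norm_blinfun_compose by metis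
    also have "\<dots> \<le> (norm (I x) * norm (g' y - g' x)) * norm (I y)"
      by (intro mult_right_mono norm_blinfun_compose) auto
    also have "\<dots> \<le> (2 * norm (g' y - g' x)) * 2"
      using I(3) that by (intro mult_mono) auto
    finally show ?thesis by (simp add: norm_minus_commute)
  qed
  have contI: "continuous_on U I"
  proof (rule continuous_onI)
    fix x and \<epsilon> :: real assume x: "x \<in> U" and "\<epsilon> > 0"
    then have "\<epsilon> / 4 > 0" by simp
    moreover have "continuous_on U g'" using cont UN continuous_on_subset by blast
    ultimately obtain \<delta> where "\<delta> > 0"
      and \<delta>: "\<And>y. y \<in> U \<Longrightarrow> dist y x < \<delta> \<Longrightarrow> dist (g' y) (g' x) < \<epsilon> / 4"
      using x unfolding continuous_on_iff by meson
    have "dist (I y) (I x) \<le> \<epsilon>" if "y \<in> U" "dist y x < \<delta>" for y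
      using Ilip[OF that(1) x] \<delta>[OF that] by (simp add: dist_norm)
    then show "\<exists>\<delta>>0. \<forall>y\<in>U. dist y x < \<delta> \<longrightarrow> dist (I y) (I x) \<le> \<epsilon>"
      using \<open>\<delta> > 0\<close> by blast
  qed
  have der\<psi>: "(\<psi> has_derivative blinfun_apply (I (\<psi> y))) (at y)" if y: "y \<in> U'" for y
  proof (rule has_derivative_inverse_basic[where T = U'])
    show "(g has_derivative blinfun_apply (g' (\<psi> y))) (at (\<psi> y))"
      using deriv UN \<psi>U y by blast
    have "blinfun_apply (I (\<psi> y) o\<^sub>L g' (\<psi> y)) = id"
      by (simp add: I(2)[OF \<psi>U[OF y]] id_blinfun.rep_eq id_def)
    then show "blinfun_apply (I (\<psi> y)) \<circ> blinfun_apply (g' (\<psi> y)) = id"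
      by (simp add: blinfun_compose.rep_eq)
    show "bounded_linear (blinfun_apply (I (\<psi> y)))" by (rule blinfun.bounded_linear_right)
    show "continuous (at y) \<psi>"
      using continuous_on_eq_continuous_at[OF \<open>open U'\<close>, of \<psi>] cont\<psi> y by simp
  qed (use y g\<psi> \<open>open U'\<close> in auto)
  have "C1_on U g"
    unfolding C1_on_def
  proof (intro exI conjI ballI)
    show "continuous_on U g'" using cont UN by (rule continuous_on_subset)
  qed (use deriv UN in blast)
  moreover have "C1_on U' \<psi>"
    unfolding C1_on_def
  proof (intro exI conjI ballI)
    show "continuous_on U' (\<lambda>y. I (\<psi> y))"
      by (rule continuous_on_compose2[OF contI cont\<psi>]) (use \<psi>U in auto)
  qed (rule der\<psi>)
  ultimately have "C1_diffeo U U' g"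
    using \<open>open U\<close> \<open>open U'\<close> bij by (simp add: C1_diffeo_def \<psi>_def)
  with pU UN show thesis by (rule that)
qed

section \<open>Existence of a zero for a map with derivative close to the identity\<close>

text \<open>
  On the closed ball of half the radius compactness improves the pointwise bound to some
  \<open>q' < q\<close>; this margin is what lets \<open>w - h w\<close> map a closed ball of radius
  \<open>s < R\<close> into itself, although the bound \<open>q\<close> alone would require \<open>s = R\<close>.
\<close>

lemma near_id_zero:
  fixes h :: "'a::real_normed_vector \<Rightarrow> 'a"
  assumes fin: "\<exists>B::'a set. finite B \<and> span B = UNIV"
    and R: "R > 0" and h0: "h 0 \<noteq> 0"
    and deriv: "\<And>w. w \<in> ball 0 R \<Longrightarrow> (h has_derivative blinfun_apply (h' w)) (at w)"
    and cont: "continuous_on (ball 0 R) h'"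
    and bound: "\<And>w. w \<in> ball 0 R \<Longrightarrow> norm (h' w - id_blinfun) < 1 - norm (h 0) / R"
  shows "\<exists>w\<in>ball 0 R. h w = 0"
proof -
  define r where "r = norm (h 0)"
  define q where "q = 1 - r / R"
  have r: "r > 0" using h0 by (simp add: r_def)
  have q1: "q < 1" using r R by (simp add: q_def)
  have bq: "norm (h' w - id_blinfun) < q" if "w \<in> ball 0 R" for w
    using bound[OF that] by (simp add: q_def r_def)
  have q0: "0 < q" using le_less_trans[OF norm_ge_zero bq[of 0]] R by simp
  have half: "cball (0::'a) (R/2) \<subseteq> ball 0 R" using R by auto
  have "\<exists>w1\<in>cball 0 (R/2). \<forall>w\<in>cball 0 (R/2). norm (h' w - id_blinfun) \<le> norm (h' w1 - id_blinfun)"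
    using R half by (intro continuous_attains_sup compact_cball_finite_dim fin continuous_intros
        continuous_on_subset[OF cont]) auto
  then obtain w1 where w1: "w1 \<in> cball 0 (R/2)"
    and w1max: "\<And>w. w \<in> cball 0 (R/2) \<Longrightarrow> norm (h' w - id_blinfun) \<le> norm (h' w1 - id_blinfun)"
    by blast
  define q' where "q' = norm (h' w1 - id_blinfun)"
  have q': "0 \<le> q'" "q' < q" using bq[of w1] w1 half by (auto simp: q'_def)
  \<comment> \<open>The amount by which the sharper constant \<open>q'\<close> on the first
    \<open>R/2\<close> of a ray improves the growth estimate.\<close>
  define \<eta> where "\<eta> = (q - q') * (R/2)"
  have \<eta>: "\<eta> > 0" using q' R by (simp add: \<eta>_def)
  \<comment> \<open>Since \<open>1 - q = r / R\<close>, the self-map condition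
    \<open>r + q * s - \<eta> \<le> s\<close> says \<open>s \<ge> R * (1 - \<eta>/r)\<close>, a
    bound below \<open>R\<close>. The maximum with \<open>R/2\<close> keeps the half ball inside the
    ball of radius \<open>s\<close>.\<close>
  define s where "s = max (R/2) (R * (1 - \<eta>/r))"
  have s: "R/2 \<le> s" "s < R" using R \<eta> r by (auto simp: s_def field_simps)
  have "r - \<eta> = R * (1 - \<eta>/r) * (r/R)" using R r by (simp add: field_simps)
  also have "\<dots> \<le> s * (r/R)" using R r by (intro mult_right_mono) (auto simp: s_def)
  finally have s_ge: "r + q * s - \<eta> \<le> s" by (simp add: q_def algebra_simps)
  have lip: "norm ((h x - x) - (h y - y)) \<le> q * norm (x - y)" if "x \<in> ball 0 R" "y \<in> ball 0 R" for x y
    by (rule near_id_lipschitz[OF convex_ball deriv less_imp_le[OF bq] that])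
  have lip': "norm ((h x - x) - (h 0 - 0)) \<le> q' * norm x" if "x \<in> cball 0 (R/2)" for x
    using near_id_lipschitz[OF convex_cball[of 0 "R/2"], of h h' q' x 0] deriv half w1max that R
    by (auto simp: q'_def)
  have growth: "norm ((h x - x) - (h 0 - 0)) \<le> q * s - \<eta>" if x: "norm x \<le> s" for x
  proof (cases "norm x \<le> R/2")
    case True
    then have "norm ((h x - x) - (h 0 - 0)) \<le> q' * norm x" using lip'[of x] by simp
    also have "\<dots> \<le> q' * (R/2)" using True q' by (intro mult_left_mono)
    also have "\<dots> = q * (R/2) - \<eta>" unfolding \<eta>_def by (simp only: left_diff_distrib diff_diff_eq2)
    also have "q * (R/2) \<le> q * s" using s q0 by (intro mult_left_mono) auto
    finally show ?thesis by simp
  next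
    case False
    then have nx: "norm x > 0" using R by linarith
    \<comment> \<open>The point where the segment from 0 to \<open>x\<close> leaves the half ball:
      the rate is \<open>q'\<close> up to \<open>m\<close> and \<open>q\<close> beyond it, in total
      \<open>q * norm x - \<eta>\<close>.\<close>
    define m where "m = (R/2 / norm x) *\<^sub>R x"
    have nm: "norm m = R/2" using nx R by (simp add: m_def)
    have "x - m = (1 - R/2 / norm x) *\<^sub>R x" by (simp add: m_def algebra_simps)
    then have "norm (x - m) = \<bar>1 - R/2 / norm x\<bar> * norm x" by simp
    also have "\<dots> = norm x - R/2" using False nx by (simp add: field_simps)
    finally have nxm: "norm (x - m) = norm x - R/2" .
    have "norm ((h x - x) - (h 0 - 0)) \<le> norm ((h x - x) - (h m - m)) + norm ((h m - m) - (h 0 - 0))"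
      by (metis diff_add_cancel add_diff_eq norm_triangle_ineq)
    also have "\<dots> \<le> q * norm (x - m) + q' * norm m"
      using lip[of x m] lip'[of m] x s nm R by (intro add_mono) auto
    also have "\<dots> = q * norm x - \<eta>" by (simp add: nxm nm \<eta>_def field_simps)
    also have "\<dots> \<le> q * s - \<eta>" using x q0 by (simp add: mult_left_mono)
    finally show ?thesis .
  qed
  have "\<exists>x\<in>cball 0 s. h x = 0"
  proof (rule near_id_solve[OF complete_UNIV_finite_dim[OF fin] less_imp_le[OF q0] q1])
    show "0 \<le> s" using s R by simp
    show "norm ((h x - x) - (h z - z)) \<le> q * norm (x - z)"
      if "x \<in> cball 0 s" "z \<in> cball 0 s" for x z
      using lip[of x z] that s by simp
    show "norm (x - h x + 0 - 0) \<le> s" if x: "x \<in> cball 0 s" for x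
    proof -
      have "norm (x - h x + 0 - 0) = norm (((h x - x) - (h 0 - 0)) + h 0)"
        by (simp add: norm_minus_commute)
      also have "\<dots> \<le> norm ((h x - x) - (h 0 - 0)) + r" unfolding r_def by (rule norm_triangle_ineq)
      also have "\<dots> \<le> s" using growth[of x] x s_ge by simp
      finally show ?thesis .
    qed
  qed
  then show ?thesis using s by auto
qed

section \<open>The zero set of a submersion as a submanifold\<close>

text \<open>The regular value theorem, with surjectivity of the derivative given as a right inverse.
  That inverse serves to build a map of the domain into itself, so the inverse function theorem
  provides the straightening chart.\<close>

lemma C1_submanifold_zero_set:
  fixes f :: "'v::real_normed_vector \<Rightarrow> 'w::real_normed_vector"
    and f' :: "'v \<Rightarrow> 'v \<Rightarrow>\<^sub>L 'w"
  assumes finV: "\<exists>B::'v set. finite B \<and> span B = UNIV"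
    and finW: "\<exists>B::'w set. finite B \<and> span B = UNIV"
    and N: "open N"
    and deriv: "\<And>x. x \<in> N \<Longrightarrow> (f has_derivative blinfun_apply (f' x)) (at x)"
    and cont: "continuous_on N f'"
    and rinv: "\<And>x. x \<in> N \<Longrightarrow> f x = 0 \<Longrightarrow> \<exists>S. f' x o\<^sub>L S = id_blinfun"
  shows "C1_submanifold {x \<in> N. f x = 0} (dim (UNIV::'v set) - dim (UNIV::'w set))"
  unfolding C1_submanifold_def
proof
  fix p assume "p \<in> {x \<in> N. f x = 0}"
  then have p: "p \<in> N" "f p = 0" by auto
  then obtain S where S: "f' p o\<^sub>L S = id_blinfun" using rinv by blast
  define D where "D = f' p"
  have DS: "D (S w) = w" for w
    using S unfolding D_def by (metis blinfun_apply_blinfun_compose id_blinfun.rep_eq)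
  \<comment> \<open>Chosen so that \<open>D (\<phi> x) = f x\<close> while \<open>\<phi>\<close> has derivative \<open>id\<close> at \<open>p\<close>.\<close>
  define \<phi> where "\<phi> x = (x - p) - S (D (x - p)) + S (f x)" for x
  define \<phi>' where "\<phi>' x = id_blinfun - (S o\<^sub>L D) + (S o\<^sub>L f' x)" for x
  have D\<phi>: "D (\<phi> x) = f x" for x
    by (simp add: \<phi>_def blinfun.add_right blinfun.diff_right DS)
  have der: "(\<phi> has_derivative blinfun_apply (\<phi>' x)) (at x)" if "x \<in> N" for x
  proof -
    have "(\<phi> has_derivative (\<lambda>v. v - S (D v) + S (f' x v))) (at x)"
      unfolding \<phi>_def using deriv[OF that] by (auto intro!: derivative_eq_intros)
    then show ?thesis
      by (simp add: \<phi>'_def plus_blinfun.rep_eq minus_blinfun.rep_eq blinfun_compose.rep_eq comp_def)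
  qed
  have "continuous_on N \<phi>'"
    unfolding \<phi>'_def by (intro continuous_intros cont bounded_bilinear.continuous_on[OF bounded_bilinear_blinfun_compose])
  moreover have "\<phi>' p = id_blinfun" by (simp add: \<phi>'_def D_def)
  ultimately obtain U U' where U: "p \<in> U" "U \<subseteq> N" "C1_diffeo U U' \<phi>"
    using local_C1_diffeo[OF complete_UNIV_finite_dim[OF finV] N p(1) der] by blast
  define L where "L = {v. D v = 0}"
  have img: "\<phi> ` U = U'" using U(3) by (auto simp: C1_diffeo_def bij_betw_def)
  have lin: "linear (blinfun_apply D)" "linear (blinfun_apply S)"
    by (auto intro: bounded_linear.linear blinfun.bounded_linear_right)
  have "subspace L" unfolding L_def using lin(1) by (rule linear_subspace_kernel)
  moreover have "dim L = dim (UNIV::'v set) - dim (UNIV::'w set)"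
    unfolding L_def by (rule dim_kernel_of_right_inverse[OF finV finW lin DS])
  \<comment> \<open>By \<open>D\<phi>\<close>, a point of \<open>U\<close> is a zero of
    \<open>f\<close> exactly when its image lies in the kernel \<open>L\<close>.\<close>
  moreover have "\<phi> ` ({x \<in> N. f x = 0} \<inter> U) = U' \<inter> L"
    using U(2) D\<phi> unfolding L_def img[symmetric] by auto
  ultimately show "\<exists>U U' \<phi> L. p \<in> U \<and> C1_diffeo U U' \<phi> \<and> subspace L \<and>
      dim L = dim (UNIV::'v set) - dim (UNIV::'w set) \<and> \<phi> ` ({x \<in> N. f x = 0} \<inter> U) = U' \<inter> L"
    using U by blast
qed

section \<open>Transfer to the given map and ball\<close>

theorem theorem3p1:
  fixes f :: "'v::real_normed_vector \<Rightarrow> 'w::real_normed_vector"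
    and f' :: "'v \<Rightarrow> 'v \<Rightarrow>\<^sub>L 'w"
    and T :: "'w \<Rightarrow>\<^sub>L 'v"
    and x0 :: 'v and e :: real
  assumes finV: "\<exists>B::'v set. finite B \<and> span B = UNIV"
    and finW: "\<exists>B::'w set. finite B \<and> span B = UNIV"
    and e_pos: "e > 0"
    and deriv: "\<And>x. x \<in> ball x0 e \<Longrightarrow> (f has_derivative blinfun_apply (f' x)) (at x)"
    and cont: "continuous_on (ball x0 e) f'"
    and bound: "\<And>x. x \<in> ball x0 e \<Longrightarrow>
                  norm ((f' x o\<^sub>L T) - id_blinfun) < 1 - norm T * norm (f x0) / e"
  shows "(\<exists>xs\<in>ball x0 e. f xs = 0)
         \<and> C1_submanifold {x \<in> ball x0 e. f x = 0} (dim (UNIV::'v set) - dim (UNIV::'w set))"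
proof
  show "\<exists>xs\<in>ball x0 e. f xs = 0"
  \<comment> \<open>If \<open>f x0 = 0\<close>, the centre is a zero; otherwise the norm of
    \<open>f x0\<close> is positive, which makes the contraction constant in
    \<open>near_id_zero\<close> less than 1.\<close>
  proof (cases "f x0 = 0")
    case True
    then show ?thesis using e_pos by (intro bexI[of _ x0]) auto
  next
    case False
    \<comment> \<open>For \<open>T = 0\<close> the bound would give the identity norm below 1,
      although it fixes the nonzero vector \<open>f x0\<close>.\<close>
    have "norm T \<noteq> 0"
    proof
      assume "norm T = 0"
      then have "norm (id_blinfun :: 'w \<Rightarrow>\<^sub>L 'w) < 1"
        using bound[of x0] e_pos by simp
      moreover have "norm (f x0) \<le> norm (id_blinfun :: 'w \<Rightarrow>\<^sub>L 'w) * norm (f x0)"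
        using norm_blinfun[of id_blinfun "f x0"] by simp
      ultimately show False using False by simp
    qed
    then have T: "norm T > 0" by simp
    \<comment> \<open>With this radius \<open>x0 + T w\<close> stays in \<open>ball x0 e\<close>,
      and \<open>norm (h 0) / R\<close> equals \<open>norm T * norm (f x0) / e\<close>, so the
      hypothesis becomes the one for \<open>h\<close>.\<close>
    define R where "R = e / norm T"
    define h where "h w = f (x0 + T w)" for w
    define h' where "h' w = f' (x0 + T w) o\<^sub>L T" for w
    have R: "R > 0" using e_pos T by (simp add: R_def)
    have inball: "x0 + T w \<in> ball x0 e" if "w \<in> ball 0 R" for w
    proof -
      have "norm (T w) \<le> norm T * norm w" by (rule norm_blinfun)
      also have "\<dots> < norm T * R" using that T by simp
      also have "\<dots> = e" using T by (simp add: R_def)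
      finally show ?thesis by (simp add: dist_norm)
    qed
    have "\<exists>w\<in>ball 0 R. h w = 0"
    proof (rule near_id_zero[OF finW R, where h' = h'])
      show "h 0 \<noteq> 0" using False by (simp add: h_def)
      show "(h has_derivative blinfun_apply (h' w)) (at w)" if "w \<in> ball 0 R" for w
      proof -
        have "((\<lambda>w. x0 + T w) has_derivative blinfun_apply T) (at w)"
          by (auto intro!: derivative_eq_intros)
        from has_derivative_compose[OF this deriv[OF inball[OF that]]]
        show ?thesis by (simp add: h_def[abs_def] h'_def blinfun_compose.rep_eq comp_def)
      qed
      have "continuous_on (ball 0 R) (\<lambda>w. f' (x0 + T w))"
        by (rule continuous_on_compose2[OF cont]) (use inball in \<open>auto intro!: continuous_intros\<close>)
      then show "continuous_on (ball 0 R) h'"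
        unfolding h'_def
        by (intro bounded_bilinear.continuous_on[OF bounded_bilinear_blinfun_compose] continuous_intros)
      show "norm (h' w - id_blinfun) < 1 - norm (h 0) / R" if "w \<in> ball 0 R" for w
        using bound[OF inball[OF that]] by (simp add: h'_def h_def R_def mult.commute)
    qed
    then show ?thesis using inball by (auto simp: h_def)
  qed
  show "C1_submanifold {x \<in> ball x0 e. f x = 0} (dim (UNIV::'v set) - dim (UNIV::'w set))"
  proof (rule C1_submanifold_zero_set[OF finV finW open_ball deriv cont])
    fix x assume x: "x \<in> ball x0 e"
    \<comment> \<open>The right side of the bound is at most 1, so the derivative composed with
      \<open>T\<close> is invertible at every point of the ball, and \<open>T\<close> after that
      inverse is a right inverse of the derivative.\<close>
    have "0 \<le> norm T * norm (f x0) / e" using e_pos by simp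
    then have "norm ((f' x o\<^sub>L T) - id_blinfun) < 1" using bound[OF x] by linarith
    from blinfun_near_id_invertible[OF complete_UNIV_finite_dim[OF finW] order_refl this]
    obtain A' where "(f' x o\<^sub>L T) o\<^sub>L A' = id_blinfun" by blast
    moreover have "(f' x o\<^sub>L T) o\<^sub>L A' = f' x o\<^sub>L (T o\<^sub>L A')"
      by (rule blinfun_eqI) simp
    ultimately have "f' x o\<^sub>L (T o\<^sub>L A') = id_blinfun" by simp
    then show "\<exists>S. f' x o\<^sub>L S = id_blinfun" by blast
  qed
qed

end
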